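(* Let $f,g\geq 1$ and $r\geq 0$ be integers, let $G$ be a graph and let $Z_0$ be a $2$-clique in $G$. Let $\mathfrak{p}=(Z_0,\ldots,Z_r;\Gamma_i:i\in[r])$ be a $(Z_0,f+g,r)$-phantom in $G$. Then one of the following holds: (a) there is an $(f,g)$-crystal in $G[Z_r]$; or (b) there are $g$ pairwise disjoint $r$-cliques $K_1,\ldots,K_g\subseteq Z_r\setminus Z_0$ in $G$ such that every vertex of $Z_0$ is adjacent to every vertex of $K_1\cup\cdots\cup K_g$.
   Context: Graphs are finite and simple; a $c$-clique is a clique of size $c$ (a $0$-clique is the empty set); $[n]=\{1,\ldots,n\}$. For $Z_0\subseteq V(G)$ and integers $d\geq1$, $r\geq0$, a $(Z_0,d,r)$-phantom in $G$ is a tuple $(Z_0,\ldots,Z_r;\Gamma_i:i\in[r])$ with $Z_0\subseteq\cdots\subseteq Z_r\subseteq V(G)$ such that for every $i\in[r]$, $\Gamma_i$ is a map with domain $E(G[Z_{i-1}])$, where for each edge $e$, $\Gamma_i(e)\subseteq Z_i\setminus Z_{i-1}$, $|\Gamma_i(e)|=d$, both ends of $e$ are adjacent to all of $\Gamma_i(e)$, and distinct edges have disjoint images. For adjacent $z_1,z_2$ in a graph $G'$, a $(z_1,z_2,f,g)$-crystal in $G'$ is a tuple $(S_{1,z},z,S_{2,z}:z\in S)$ with $S$ an $f$-subset of $V(G')\setminus\{z_1,z_2\}$, the sets $S_{1,z},S_{2,z}$ ($z\in S$) pairwise disjoint $g$-subsets of $V(G')\setminus(S\cup\{z_1,z_2\})$,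 and for each $i\in\{1,2\}$, $z\in S$, $x\in S_{i,z}$, the neighbors of $x$ in $\{z_1,z_2,z\}$ are exactly $\{z_i,z\}$. An $(f,g)$-crystal in $G'$ is a $(z_1,z_2,f,g)$-crystal in $G'$ for some adjacent pair $z_1,z_2$ of $G'$. *)

theory Defs
  imports "HOL-Library.Disjoint_Sets"
begin

record 'a ugraph =
  verts :: "'a set"
  edges :: "'a set set"

definition fin_simple_graph :: "'a ugraph \<Rightarrow> bool" where
  "fin_simple_graph G \<longleftrightarrow>
     finite (verts G) \<and> (\<forall>e\<in>edges G. e \<subseteq> verts G \<and> card e = 2)"

definition adj :: "'a ugraph \<Rightarrow> 'a \<Rightarrow> 'a \<Rightarrow> bool" where
  "adj G x y \<longleftrightarrow> {x, y} \<in> edges G"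

definition nbrs :: "'a ugraph \<Rightarrow> 'a \<Rightarrow> 'a set" where
  "nbrs G x = {y. adj G x y}"

definition induced :: "'a ugraph \<Rightarrow> 'a set \<Rightarrow> 'a ugraph" where
  "induced G X = \<lparr>verts = verts G \<inter> X, edges = {e \<in> edges G. e \<subseteq> X}\<rparr>"

definition is_clique :: "'a ugraph \<Rightarrow> nat \<Rightarrow> 'a set \<Rightarrow> bool" where
  "is_clique G c K \<longleftrightarrow>
     K \<subseteq> verts G \<and> finite K \<and> card K = c \<and> (\<forall>x\<in>K. \<forall>y\<in>K. x \<noteq> y \<longrightarrow> adj G x y)"

text \<open>
  The tuple $(Z_0,\ldots,Z_r;\Gamma_i : i \in [r])$ is encoded by total functions \<open>Z\<close> and \<open>\<Gamma>\<close>.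
  Only the values \<open>Z i\<close> for \<open>i \<le> r\<close>, and \<open>\<Gamma> i e\<close> for \<open>1 \<le> i \<le> r\<close> and
  \<open>e\<close> an edge of the subgraph induced on \<open>Z (i - 1)\<close>, are constrained.
\<close>

definition phantom ::
  "'a ugraph \<Rightarrow> 'a set \<Rightarrow> nat \<Rightarrow> nat \<Rightarrow> (nat \<Rightarrow> 'a set) \<Rightarrow> (nat \<Rightarrow> 'a set \<Rightarrow> 'a set) \<Rightarrow> bool" where
  "phantom G Z0 d r Z \<Gamma> \<longleftrightarrow>
     1 \<le> d \<and> Z 0 = Z0 \<and> (\<forall>i\<in>{1..r}. Z (i - 1) \<subseteq> Z i) \<and> Z r \<subseteq> verts G \<and>
     (\<forall>i\<in>{1..r}.
        (\<forall>e\<in>edges (induced G (Z (i - 1))).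
           \<Gamma> i e \<subseteq> Z i - Z (i - 1) \<and> card (\<Gamma> i e) = d \<and>
           (\<forall>u\<in>e. \<forall>x\<in>\<Gamma> i e. adj G u x)) \<and>
        disjoint_family_on (\<Gamma> i) (edges (induced G (Z (i - 1)))))"

definition crystal_at ::
  "'a ugraph \<Rightarrow> 'a \<Rightarrow> 'a \<Rightarrow> nat \<Rightarrow> nat \<Rightarrow> 'a set \<Rightarrow> ('a \<Rightarrow> 'a set) \<Rightarrow> ('a \<Rightarrow> 'a set) \<Rightarrow> bool" where
  "crystal_at G z1 z2 f g S S1 S2 \<longleftrightarrow>
     adj G z1 z2 \<and>
     S \<subseteq> verts G - {z1, z2} \<and> finite S \<and> card S = f \<and>
     (\<forall>z\<in>S. \<forall>T\<in>{S1 z, S2 z}.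
        T \<subseteq> verts G - (S \<union> {z1, z2}) \<and> finite T \<and> card T = g) \<and>
     disjoint_family_on S1 S \<and> disjoint_family_on S2 S \<and>
     (\<forall>z\<in>S. \<forall>z'\<in>S. S1 z \<inter> S2 z' = {}) \<and>
     (\<forall>z\<in>S. \<forall>x\<in>S1 z. nbrs G x \<inter> {z1, z2, z} = {z1, z}) \<and>
     (\<forall>z\<in>S. \<forall>x\<in>S2 z. nbrs G x \<inter> {z1, z2, z} = {z2, z})"

definition has_crystal :: "'a ugraph \<Rightarrow> nat \<Rightarrow> nat \<Rightarrow> bool" where
  "has_crystal G f g \<longleftrightarrow> (\<exists>z1 z2 S S1 S2. crystal_at G z1 z2 f g S S1 S2)"

end

theory Submission
  imports Defs
begin

text \<open>
  Suppose that \<open>G[Z r]\<close> has no crystal. By downward induction on \<open>k\<close>, every edge \<open>e\<close> of \<open>G[Z k]\<close> has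
  \<open>g\<close> cliques of size \<open>r - k\<close> in \<open>Z r - Z k\<close> that are complete to \<open>e\<close>; the induction needs these
  cliques to be pairwise disjoint over all edges \<open>e\<close> simultaneously. For the step, let
  \<open>e = {z1, z2}\<close> and look at the \<open>f + g\<close> vertices \<open>z\<close> of \<open>\<Gamma> (k + 1) e\<close>. If one of the cliques
  belonging to the edges \<open>{z1, z}\<close> and \<open>{z2, z}\<close> is complete to \<open>e\<close>, then adding \<open>z\<close> to it gives a
  clique for \<open>e\<close>. If this fails for \<open>f\<close> vertices \<open>z\<close>, then each clique of \<open>{z1, z}\<close> contains a
  non-neighbour of \<open>z2\<close> and vice versa, and these vertices form a crystal.
\<close>

section \<open>Disjoint cliques attached to the edges of a level\<close>

text \<open>In use \<open>A\<close> is a level \<open>Z k\<close>, \<open>B\<close> is the last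
  level \<open>Z r\<close>, and \<open>m\<close> is \<open>r - k\<close>. The family is indexed by
  pairs of an edge and a number so that disjointness also covers cliques of different edges.\<close>

definition clique_system ::
  "'a ugraph \<Rightarrow> nat \<Rightarrow> nat \<Rightarrow> 'a set \<Rightarrow> 'a set \<Rightarrow> ('a set \<Rightarrow> nat \<Rightarrow> 'a set) \<Rightarrow> bool" where
  "clique_system G g m A B K \<longleftrightarrow>
     (\<forall>e\<in>edges (induced G A). \<forall>j\<in>{1..g}.
        is_clique G m (K e j) \<and> K e j \<subseteq> B - A \<and> (\<forall>u\<in>e. \<forall>x\<in>K e j. adj G u x)) \<and>
     disjoint_family_on (\<lambda>(e, j). K e j) (edges (induced G A) \<times> {1..g})"

lemma clique_systemD:
  assumes "clique_system G g m A B K" "e \<in> edges (induced G A)" "j \<in> {1..g}"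
  shows "is_clique G m (K e j)" "K e j \<subseteq> B - A" "\<And>u x. u \<in> e \<Longrightarrow> x \<in> K e j \<Longrightarrow> adj G u x"
  using assms unfolding clique_system_def by blast+

lemma clique_system_disjoint:
  assumes "clique_system G g m A B K"
    and "e \<in> edges (induced G A)" "j \<in> {1..g}" "e' \<in> edges (induced G A)" "j' \<in> {1..g}"
    and "(e, j) \<noteq> (e', j')"
  shows "K e j \<inter> K e' j' = {}"
proof -
  have "disjoint_family_on (\<lambda>(e, j). K e j) (edges (induced G A) \<times> {1..g})"
    using assms(1) unfolding clique_system_def by blast
  from disjoint_family_onD[OF this, of "(e, j)" "(e', j')"] show ?thesis
    using assms(2-) by auto
qed

lemma edges_induced: "e \<in> edges (induced G X) \<longleftrightarrow> e \<in> edges G \<and> e \<subseteq> X"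
  by (simp add: induced_def)

lemma verts_induced: "verts (induced G X) = verts G \<inter> X"
  by (simp add: induced_def)

lemma adj_induced: "adj (induced G X) x y \<longleftrightarrow> adj G x y \<and> x \<in> X \<and> y \<in> X"
  by (simp add: adj_def induced_def)

lemma adj_commute: "adj G x y \<longleftrightarrow> adj G y x"
  by (simp add: adj_def insert_commute)

section \<open>Crystals from cliques that miss one end of an edge\<close>

text \<open>This builds one of the two sides of a crystal: \<open>T z\<close> takes one
  non-neighbour of \<open>z2\<close> from each of the \<open>g\<close> cliques of the edge
  \<open>{z1, z}\<close>. Disjointness of the cliques makes the chosen vertices distinct, both for
  one \<open>z\<close> and across all of \<open>S\<close>.\<close>

lemma clique_system_transversal:
  assumes sys: "clique_system G g m A B K" and "z1 \<in> A" "S \<subseteq> A"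
    and adj1: "\<And>z. z \<in> S \<Longrightarrow> adj G z1 z"
    and bad: "\<And>z j. z \<in> S \<Longrightarrow> j \<in> {1..g} \<Longrightarrow> \<exists>x\<in>K {z1, z} j. \<not> adj G z2 x"
  obtains T where "\<And>z. z \<in> S \<Longrightarrow> T z \<subseteq> B - A \<and> finite (T z) \<and> card (T z) = g"
    and "disjoint_family_on T S"
    and "\<And>z x. z \<in> S \<Longrightarrow> x \<in> T z \<Longrightarrow> adj G z1 x \<and> adj G z x \<and> \<not> adj G z2 x"
proof -
  have edge: "{z1, z} \<in> edges (induced G A)" if "z \<in> S" for z
    using adj1[OF that] that assms(2,3) by (auto simp: edges_induced adj_def)
  have "\<forall>z j. \<exists>x. z \<in> S \<longrightarrow> j \<in> {1..g} \<longrightarrow> x \<in> K {z1, z} j \<and> \<not> adj G z2 x"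
    using bad by blast
  then obtain p where "\<forall>z j. z \<in> S \<longrightarrow> j \<in> {1..g} \<longrightarrow> p z j \<in> K {z1, z} j \<and> \<not> adj G z2 (p z j)"
    by metis
  then have p: "p z j \<in> K {z1, z} j" "\<not> adj G z2 (p z j)" if "z \<in> S" "j \<in> {1..g}" for z j
    using that by blast+
  have p_inj: "z = z' \<and> j = j'"
    if "z \<in> S" "j \<in> {1..g}" "z' \<in> S" "j' \<in> {1..g}" "p z j = p z' j'" for z j z' j'
  proof -
    \<comment> \<open>Cliques with different indices have no common vertex. Since \<open>z1\<close>
      is fixed, the edge \<open>{z1, z}\<close> determines \<open>z\<close>.\<close>
    have "({z1, z}, j) = ({z1, z'}, j')"
      using clique_system_disjoint[OF sys edge[OF that(1)] that(2) edge[OF that(3)] that(4)]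
        p(1)[OF that(1,2)] p(1)[OF that(3,4)] that(5) by auto
    then show ?thesis
      by (auto simp: doubleton_eq_iff)
  qed
  define T where "T z = p z ` {1..g}" for z
  show ?thesis
  proof
    fix z assume z: "z \<in> S"
    have "inj_on (p z) {1..g}"
      using p_inj z by (blast intro: inj_onI)
    then have "card (T z) = g"
      by (simp add: T_def card_image)
    moreover have "T z \<subseteq> B - A"
      using p(1)[OF z] clique_systemD(2)[OF sys edge[OF z]] unfolding T_def by blast
    ultimately show "T z \<subseteq> B - A \<and> finite (T z) \<and> card (T z) = g"
      by (simp add: T_def)
  next
    show "disjoint_family_on T S"
      unfolding disjoint_family_on_def T_def using p_inj by blast
  next
    fix z x assume "z \<in> S" "x \<in> T z"
    then show "adj G z1 x \<and> adj G z x \<and> \<not> adj G z2 x"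
      using p clique_systemD(3)[OF sys edge] unfolding T_def by blast
  qed
qed

text \<open>The two sides are transversals with the roles of \<open>z1\<close> and \<open>z2\<close>
  exchanged. They lie outside \<open>A\<close>, hence avoid \<open>S\<close>, \<open>z1\<close> and
  \<open>z2\<close>, which all lie in \<open>A\<close>.\<close>

lemma clique_system_crystal:
  assumes sys: "clique_system G g m A B K"
    and "B \<subseteq> verts G" "A \<subseteq> B" "adj G z1 z2" "z1 \<in> A" "z2 \<in> A" "S \<subseteq> A - {z1, z2}"
    and "\<And>z. z \<in> S \<Longrightarrow> adj G z1 z" "\<And>z. z \<in> S \<Longrightarrow> adj G z2 z"
    and "\<And>z j. z \<in> S \<Longrightarrow> j \<in> {1..g} \<Longrightarrow> \<exists>x\<in>K {z1, z} j. \<not> adj G z2 x"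
    and "\<And>z j. z \<in> S \<Longrightarrow> j \<in> {1..g} \<Longrightarrow> \<exists>x\<in>K {z2, z} j. \<not> adj G z1 x"
    and "finite S" "card S = f"
  shows "has_crystal (induced G B) f g"
proof -
  have "S \<subseteq> A"
    using assms(7) by blast
  obtain S1 where S1: "\<And>z. z \<in> S \<Longrightarrow> S1 z \<subseteq> B - A \<and> finite (S1 z) \<and> card (S1 z) = g"
    "disjoint_family_on S1 S"
    "\<And>z x. z \<in> S \<Longrightarrow> x \<in> S1 z \<Longrightarrow> adj G z1 x \<and> adj G z x \<and> \<not> adj G z2 x"
    using clique_system_transversal[OF sys assms(5) \<open>S \<subseteq> A\<close> assms(8,10)] by blast
  obtain S2 where S2: "\<And>z. z \<in> S \<Longrightarrow> S2 z \<subseteq> B - A \<and> finite (S2 z) \<and> card (S2 z) = g"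
    "disjoint_family_on S2 S"
    "\<And>z x. z \<in> S \<Longrightarrow> x \<in> S2 z \<Longrightarrow> adj G z2 x \<and> adj G z x \<and> \<not> adj G z1 x"
    using clique_system_transversal[OF sys assms(6) \<open>S \<subseteq> A\<close> assms(9,11)] by blast
  have in_B: "z1 \<in> B" "z2 \<in> B" "S \<subseteq> B"
    using assms(3,5,6,7) by auto
  have "crystal_at (induced G B) z1 z2 f g S S1 S2"
    unfolding crystal_at_def
  proof (intro conjI ballI)
    show "adj (induced G B) z1 z2"
      using assms(4) in_B by (simp add: adj_induced)
    show "S \<subseteq> verts (induced G B) - {z1, z2}"
      using assms(2,7) in_B by (auto simp: verts_induced)
    fix z T assume "z \<in> S" "T \<in> {S1 z, S2 z}"
    then have T: "T \<subseteq> B - A \<and> finite T \<and> card T = g"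
      using S1(1) S2(1) by auto
    then show "finite T" "card T = g"
      by auto
    show "T \<subseteq> verts (induced G B) - (S \<union> {z1, z2})"
      using T assms(2,5,6,7) by (auto simp: verts_induced)
  next
    \<comment> \<open>A common vertex would be both adjacent and non-adjacent to
      \<open>z2\<close>.\<close>
    fix z z' assume "z \<in> S" "z' \<in> S"
    then show "S1 z \<inter> S2 z' = {}"
      using S1(3) S2(3) by blast
  next
    fix z x assume zx: "z \<in> S" "x \<in> S1 z"
    have "x \<in> B" "z \<in> B"
      using S1(1) zx in_B by auto
    then show "nbrs (induced G B) x \<inter> {z1, z2, z} = {z1, z}"
      using S1(3)[OF zx] in_B by (auto simp: nbrs_def adj_induced adj_commute)
  next
    fix z x assume zx: "z \<in> S" "x \<in> S2 z"
    have "x \<in> B" "z \<in> B"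
      using S2(1) zx in_B by auto
    then show "nbrs (induced G B) x \<inter> {z1, z2, z} = {z2, z}"
      using S2(3)[OF zx] in_B by (auto simp: nbrs_def adj_induced adj_commute)
  qed (use S1(2) S2(2) assms(12,13) in auto)
  then show ?thesis
    unfolding has_crystal_def by blast
qed

text \<open>A vertex \<open>z\<close> counts as good if some clique of an edge from an end of
  \<open>e\<close> to \<open>z\<close> is complete to all of \<open>e\<close>. With fewer than
  \<open>g\<close> good vertices, at least \<open>f\<close> of the \<open>f + g\<close> vertices in
  \<open>D\<close> remain, and \<open>f\<close> of these serve as the set \<open>S\<close> of a
  crystal.\<close>

lemma many_good_vertices:
  assumes "fin_simple_graph G" and sys: "clique_system G g m A' B K"
    and "A \<subseteq> A'" "A' \<subseteq> B" "B \<subseteq> verts G"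
    and e: "e \<in> edges (induced G A)"
    and D: "D \<subseteq> A' - A" "card D = f + g" "\<And>u x. u \<in> e \<Longrightarrow> x \<in> D \<Longrightarrow> adj G u x"
    and no: "\<not> has_crystal (induced G B) f g"
  shows "g \<le> card {z\<in>D. \<exists>u\<in>e. \<exists>j\<in>{1..g}. \<forall>w\<in>e. \<forall>x\<in>K {u, z} j. adj G w x}"
    (is "_ \<le> card ?good")
proof (rule ccontr)
  assume "\<not> g \<le> card ?good"
  have "finite (verts G)"
    using assms(1) by (simp add: fin_simple_graph_def)
  then have fin: "finite D"
    using assms(4,5) D(1) by (meson Diff_subset finite_subset)
  have "card (D - ?good) = card D - card ?good"
    using fin by (intro card_Diff_subset) auto
  then have "f \<le> card (D - ?good)"
    using \<open>\<not> g \<le> card ?good\<close> D(2) by linarith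
  then obtain S where S: "S \<subseteq> D - ?good" "card S = f" "finite S"
    by (rule obtain_subset_with_card_n)
  have "e \<in> edges G" "e \<subseteq> A"
    using e by (auto simp: edges_induced)
  then obtain z1 z2 where z12: "e = {z1, z2}"
    using assms(1) unfolding fin_simple_graph_def by (metis card_2_iff)
  have bad: "\<exists>w\<in>e. \<exists>x\<in>K {u, z} j. \<not> adj G w x" if "z \<in> S" "u \<in> e" "j \<in> {1..g}" for z u j
    using S(1) that by blast
  have compl: "adj G u x" if "z \<in> S" "u \<in> e" "j \<in> {1..g}" "x \<in> K {u, z} j" for z u j x
  proof -
    have "{u, z} \<in> edges (induced G A')"
      using D(1) D(3)[OF that(2), of z] that(1,2) S(1) \<open>e \<subseteq> A\<close> assms(3)
      by (auto simp: edges_induced adj_def)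
    then show ?thesis
      using clique_systemD(3)[OF sys _ that(3) _ that(4)] by blast
  qed
  have "has_crystal (induced G B) f g"
  proof (rule clique_system_crystal[OF sys assms(5,4)])
    show "adj G z1 z2"
      using \<open>e \<in> edges G\<close> z12 by (simp add: adj_def)
    show "z1 \<in> A'" "z2 \<in> A'"
      using \<open>e \<subseteq> A\<close> assms(3) z12 by auto
    show "S \<subseteq> A' - {z1, z2}"
      using \<open>e \<subseteq> A\<close> S(1) D(1) z12 by blast
    show "adj G z1 z" "adj G z2 z" if "z \<in> S" for z
      using that S(1) D(3) z12 by auto
    \<comment> \<open>By \<open>bad\<close>, some end of \<open>e\<close> has a non-neighbour in
      this clique; by \<open>compl\<close> that end is not \<open>z1\<close>, so it is
      \<open>z2\<close>.\<close>
    show "\<exists>x\<in>K {z1, z} j. \<not> adj G z2 x" if "z \<in> S" "j \<in> {1..g}" for z j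
      using bad[OF that(1) _ that(2), of z1] compl[OF that(1) _ that(2), of z1] z12 by auto
    show "\<exists>x\<in>K {z2, z} j. \<not> adj G z1 x" if "z \<in> S" "j \<in> {1..g}" for z j
      using bad[OF that(1) _ that(2), of z2] compl[OF that(1) _ that(2), of z2] z12 by auto
  qed (use S in auto)
  with no show False ..
qed

section \<open>Descending induction along the phantom\<close>

text \<open>For each edge \<open>e\<close> of the smaller level, \<open>g\<close> good vertices of
  \<open>D e\<close> are chosen, and each is joined to a clique of size \<open>m\<close> that
  witnesses its goodness.\<close>

lemma clique_system_step:
  assumes "fin_simple_graph G" and sys: "clique_system G g m A' B K"
    and "A \<subseteq> A'" "A' \<subseteq> B" "B \<subseteq> verts G"
    and D: "\<And>e. e \<in> edges (induced G A) \<Longrightarrow> D e \<subseteq> A' - A \<and> card (D e) = f + g"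
      "\<And>e u x. e \<in> edges (induced G A) \<Longrightarrow> u \<in> e \<Longrightarrow> x \<in> D e \<Longrightarrow> adj G u x"
    and disj: "disjoint_family_on D (edges (induced G A))"
    and no: "\<not> has_crystal (induced G B) f g"
  obtains K' where "clique_system G g (Suc m) A B K'"
proof -
  let ?E = "edges (induced G A)"
  define good where
    "good e = {z\<in>D e. \<exists>u\<in>e. \<exists>j\<in>{1..g}. \<forall>w\<in>e. \<forall>x\<in>K {u, z} j. adj G w x}" for e
  have "\<exists>h. inj_on h {1..g} \<and> h ` {1..g} \<subseteq> good e" if "e \<in> ?E" for e
  proof -
    have "g \<le> card (good e)"
      unfolding good_def
      using many_good_vertices[OF assms(1-5) that _ _ _ no] D(1)[OF that] D(2)[OF that] by blast
    then obtain T where T: "T \<subseteq> good e" "card T = g" "finite T"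
      by (rule obtain_subset_with_card_n)
    then obtain h where "bij_betw h {1..g} T"
      using ex_bij_betw_nat_finite_1 by blast
    then show ?thesis
      using T(1) by (auto simp: bij_betw_def)
  qed
  then obtain h where h: "inj_on (h e) {1..g}" "h e ` {1..g} \<subseteq> good e" if "e \<in> ?E" for e
    by metis
  then have "\<forall>e j. \<exists>u i. e \<in> ?E \<longrightarrow> j \<in> {1..g} \<longrightarrow>
      u \<in> e \<and> i \<in> {1..g} \<and> (\<forall>w\<in>e. \<forall>x\<in>K {u, h e j} i. adj G w x)"
    unfolding good_def by blast
  then obtain u i where "\<forall>e j. e \<in> ?E \<longrightarrow> j \<in> {1..g} \<longrightarrow>
      u e j \<in> e \<and> i e j \<in> {1..g} \<and> (\<forall>w\<in>e. \<forall>x\<in>K {u e j, h e j} (i e j). adj G w x)"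
    unfolding choice_iff by blast
  then have ui: "u e j \<in> e" "i e j \<in> {1..g}"
    "\<forall>w\<in>e. \<forall>x\<in>K {u e j, h e j} (i e j). adj G w x" if "e \<in> ?E" "j \<in> {1..g}" for e j
    using that by blast+
  have hD: "h e j \<in> D e" "h e j \<in> A'" "h e j \<notin> A" if "e \<in> ?E" "j \<in> {1..g}" for e j
  proof -
    show "h e j \<in> D e"
      using h(2)[OF that(1)] that(2) unfolding good_def by blast
    then show "h e j \<in> A'" "h e j \<notin> A"
      using D(1)[OF that(1)] by auto
  qed
  have uA: "u e j \<in> A" if "e \<in> ?E" "j \<in> {1..g}" for e j
    using ui(1)[OF that] that(1) by (auto simp: edges_induced)
  have edge: "{u e j, h e j} \<in> edges (induced G A')" if "e \<in> ?E" "j \<in> {1..g}" for e j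
    using D(2)[OF that(1) ui(1)[OF that] hD(1)[OF that]] uA[OF that] hD(2)[OF that] assms(3)
    by (auto simp: edges_induced adj_def)
  have h_inj: "e = e' \<and> j = j'"
    if "e \<in> ?E" "j \<in> {1..g}" "e' \<in> ?E" "j' \<in> {1..g}" "h e j = h e' j'" for e j e' j'
  proof -
    \<comment> \<open>Different edges are separated by disjointness of their sets
      \<open>D e\<close>; for one edge, \<open>h e\<close> is injective.\<close>
    have "e = e'"
      using disjoint_family_onD[OF disj that(1,3)] hD(1)[OF that(1,2)] hD(1)[OF that(3,4)] that(5)
      by auto
    then show ?thesis
      using inj_onD[OF h(1)[OF that(1)]] that by auto
  qed
  define L where "L e j = K {u e j, h e j} (i e j)" for e j
  have L: "is_clique G m (L e j)" "L e j \<subseteq> B - A'" "\<And>x. x \<in> L e j \<Longrightarrow> adj G (h e j) x"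
    if "e \<in> ?E" "j \<in> {1..g}" for e j
    using clique_systemD[OF sys edge[OF that] ui(2)[OF that]] unfolding L_def by auto
  have "clique_system G g (Suc m) A B (\<lambda>e j. insert (h e j) (L e j))"
    unfolding clique_system_def
  proof (intro conjI ballI)
    fix e j assume ej: "e \<in> ?E" "j \<in> {1..g}"
    have "h e j \<notin> L e j" "h e j \<in> verts G"
      using L(2)[OF ej] hD(2)[OF ej] assms(4,5) by auto
    then show "is_clique G (Suc m) (insert (h e j) (L e j))"
      using L(1,3)[OF ej] unfolding is_clique_def by (auto simp: adj_commute)
    show "insert (h e j) (L e j) \<subseteq> B - A"
      using L(2)[OF ej] hD(2,3)[OF ej] assms(3,4) by auto
    fix w x assume "w \<in> e" "x \<in> insert (h e j) (L e j)"
    then show "adj G w x"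
      using D(2)[OF ej(1) _ hD(1)[OF ej]] ui(3)[OF ej] unfolding L_def by auto
  next
    have "insert (h e j) (L e j) \<inter> insert (h e' j') (L e' j') = {}"
      if ej: "e \<in> ?E" "j \<in> {1..g}" and ej': "e' \<in> ?E" "j' \<in> {1..g}" and "(e, j) \<noteq> (e', j')"
      for e j e' j'
    proof -
      have "h e j \<noteq> h e' j'"
        using h_inj[OF ej ej'] that(5) by auto
      \<comment> \<open>As the \<open>h\<close>-vertices differ, equality of these edges would force
        \<open>h e j = u e' j'\<close>; but \<open>h e j\<close> lies outside \<open>A\<close> and
        \<open>u e' j'\<close> inside. So the two old cliques belong to different edges.\<close>
      moreover from this have "{u e j, h e j} \<noteq> {u e' j', h e' j'}"
        using uA[OF ej'] hD(3)[OF ej] by (auto simp: doubleton_eq_iff)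
      then have "L e j \<inter> L e' j' = {}"
        unfolding L_def
        using clique_system_disjoint[OF sys edge[OF ej] ui(2)[OF ej] edge[OF ej'] ui(2)[OF ej']]
        by auto
      \<comment> \<open>The added vertices lie in \<open>A'\<close>, the old cliques outside
        it.\<close>
      moreover have "h e j \<notin> L e' j'" "h e' j' \<notin> L e j"
        using hD(2)[OF ej] hD(2)[OF ej'] L(2)[OF ej] L(2)[OF ej'] by auto
      ultimately show ?thesis
        by auto
    qed
    then show "disjoint_family_on (\<lambda>(e, j). insert (h e j) (L e j)) (?E \<times> {1..g})"
      unfolding disjoint_family_on_def by fast
  qed
  then show ?thesis ..
qed

text \<open>The inclusion in \<open>Z r\<close> is carried through the induction because a phantom
  only gives inclusions between consecutive levels.\<close>

lemma phantom_clique_system: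
  assumes "fin_simple_graph G" "phantom G Z0 (f + g) r Z \<Gamma>"
    and "\<not> has_crystal (induced G (Z r)) f g" "k \<le> r"
  shows "Z k \<subseteq> Z r \<and> (\<exists>K. clique_system G g (r - k) (Z k) (Z r) K)"
  using \<open>k \<le> r\<close>
proof (induction rule: inc_induct)
  case base
  \<comment> \<open>At the last level every clique is the empty set, which is a
    \<open>0\<close>-clique and disjoint from itself.\<close>
  have "clique_system G g 0 (Z r) (Z r) (\<lambda>e j. {})"
    unfolding clique_system_def is_clique_def disjoint_family_on_def by auto
  then show ?case
    by auto
next
  case (step k)
  then obtain K where K: "clique_system G g (r - Suc k) (Z (Suc k)) (Z r) K"
    and sub: "Z (Suc k) \<subseteq> Z r"
    by blast
  \<comment> \<open>The map for the edges of level \<open>k\<close> has index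
    \<open>k + 1\<close>.\<close>
  have "Suc k \<in> {1..r}"
    using step.hyps by auto
  then have ph: "Z k \<subseteq> Z (Suc k)" "Z r \<subseteq> verts G"
    "\<And>e. e \<in> edges (induced G (Z k)) \<Longrightarrow>
      \<Gamma> (Suc k) e \<subseteq> Z (Suc k) - Z k \<and> card (\<Gamma> (Suc k) e) = f + g"
    "\<And>e u x. e \<in> edges (induced G (Z k)) \<Longrightarrow> u \<in> e \<Longrightarrow> x \<in> \<Gamma> (Suc k) e \<Longrightarrow> adj G u x"
    "disjoint_family_on (\<Gamma> (Suc k)) (edges (induced G (Z k)))"
    using assms(2) unfolding phantom_def by (metis diff_Suc_1)+
  obtain K' where "clique_system G g (Suc (r - Suc k)) (Z k) (Z r) K'"
    by (rule clique_system_step[OF assms(1) K ph(1) sub ph(2) _ _ ph(5) assms(3)])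
      (use ph(3,4) in blast)+
  moreover have "Suc (r - Suc k) = r - k"
    using step.hyps by simp
  ultimately show ?case
    using ph(1) sub by auto
qed

theorem theorem4p2:
  fixes G :: "'a ugraph" and f g r :: nat and Z0 :: "'a set"
    and Z :: "nat \<Rightarrow> 'a set" and \<Gamma> :: "nat \<Rightarrow> 'a set \<Rightarrow> 'a set"
  assumes "fin_simple_graph G"
    and "1 \<le> f" and "1 \<le> g"
    and "is_clique G 2 Z0"
    and "phantom G Z0 (f + g) r Z \<Gamma>"
  shows "has_crystal (induced G (Z r)) f g \<or>
    (\<exists>K :: nat \<Rightarrow> 'a set.
       disjoint_family_on K {1..g} \<and>
       (\<forall>j\<in>{1..g}. is_clique G r (K j) \<and> K j \<subseteq> Z r - Z0) \<and>
       (\<forall>z\<in>Z0. \<forall>x\<in>(\<Union>j\<in>{1..g}. K j). adj G z x))"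
proof (cases "has_crystal (induced G (Z r)) f g")
  case False
  then obtain K where K: "clique_system G g r Z0 (Z r) K"
    using phantom_clique_system[OF assms(1,5), of 0] assms(5) by (auto simp: phantom_def)
  \<comment> \<open>A \<open>2\<close>-clique is itself an edge, so its own \<open>g\<close> cliques
    in the system at level \<open>0\<close> are those required.\<close>
  have "Z0 \<in> edges (induced G Z0)"
    using assms(4) unfolding is_clique_def edges_induced by (auto simp: card_2_iff adj_def)
  then have "disjoint_family_on (K Z0) {1..g}"
    using clique_system_disjoint[OF K] by (auto simp: disjoint_family_on_def)
  then show ?thesis
    using clique_systemD[OF K \<open>Z0 \<in> edges (induced G Z0)\<close>]
    by (intro disjI2 exI[of _ "K Z0"]) blast
qed simp

end
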